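(* Let $D\ge 1$, let $P\subset\mathbb{R}^D$ be a set of $N\ge 2$ points, let $\epsilon\in(0,1)$ and $c>0$, and let $k$ be a positive integer with $$k\ \geq\ \frac{C}{\epsilon^2(1-\epsilon)^2}\ln(N^{c+2}),\qquad C=64\left(\frac{\pi^2}{2}+\frac{16\sqrt{2}}{e\pi}e^{\operatorname{atanh}(1/\sqrt{2})}\right).$$ Let $F:\mathbb{R}^D\to\mathbb{R}^k$ be the random linear map whose matrix entries are i.i.d. standard Cauchy random variables. Then, with probability at least $1-N^{-c}$, the bound $$\mu\left(\frac{\|x-y\|_1}{1+\epsilon}\right)\leq \rho\big(F(x),F(y)\big)\leq \mu\big((1+\epsilon)\|x-y\|_1\big)$$ holds simultaneously for all $x,y\in P$ with $\|x-y\|_1\geq\sqrt{1+\epsilon}$.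
   Context: $\mathrm{Cauchy}(1)$ is the standard Cauchy distribution on $\mathbb{R}$, with density $\frac{1}{\pi(1+x^2)}$. For $\lambda\ge 0$ define $\xi(\lambda):=\ln(1+\sqrt{\lambda})+\frac12\ln(1+\lambda)$ and $\mu(\lambda):=\mathbb{E}\,\xi(\lambda|X|)$ with $X\sim\mathrm{Cauchy}(1)$. For $u,v\in\mathbb{R}^k$ define the metric $\rho(u,v):=\frac1k\sum_{i=1}^k\xi(|u_i-v_i|)$. $\|\cdot\|_1$ is the 1-norm on $\mathbb{R}^D$. *)

theory Defs
  imports "HOL-Probability.Probability"
begin

definition cauchy_density :: "real \<Rightarrow> real" where
  "cauchy_density x = 1 / (pi * (1 + x\<^sup>2))"

definition cauchy :: "real measure" where
  "cauchy = density lborel (\<lambda>x. ennreal (cauchy_density x))"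

definition xi :: "real \<Rightarrow> real" where
  "xi t = ln (1 + sqrt t) + 1 / 2 * ln (1 + t)"

text \<open>For \<open>t \<ge> 0\<close> the integrand grows only logarithmically, so it is integrable with respect to
  \<open>cauchy\<close> and the Bochner integral is the genuine expectation.\<close>

definition mu :: "real \<Rightarrow> real" where
  "mu t = (\<integral>x. xi (t * \<bar>x\<bar>) \<partial>cauchy)"

definition rho :: "real ^ 'k \<Rightarrow> real ^ 'k \<Rightarrow> real" where
  "rho u v = 1 / real CARD('k) * (\<Sum>i\<in>UNIV. xi \<bar>u $ i - v $ i\<bar>)"

definition norm_1 :: "real ^ 'd \<Rightarrow> real" where
  "norm_1 x = (\<Sum>j\<in>UNIV. \<bar>x $ j\<bar>)"

end

theory Submission
  imports Defs "HOL-Real_Asymp.Real_Asymp"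
begin

text \<open>
  By stability, every coordinate of \<open>F x - F y\<close> is \<open>l\<close> times a standard Cauchy variable, where
  \<open>l = norm_1 (x - y)\<close>, so \<open>rho (F x) (F y)\<close> is a mean of independent copies of \<open>xi (l * \<bar>X\<bar>)\<close>.
  On a logarithmic scale \<open>xi\<close> is 1-Lipschitz, hence \<open>xi (l * \<bar>X\<bar>) - xi l\<close> is dominated by
  \<open>\<bar>ln \<bar>X\<bar>\<bar>\<close>; this yields a subgaussian moment generating function near 0 and a Chernoff bound with
  constants independent of \<open>l\<close>.  The invariance of the law of \<open>X\<close> under inversion shows that
  \<open>mu b - mu a \<ge> ln (b / a) / 2\<close> when \<open>a * b \<ge> 1\<close>, so a deviation of \<open>rho\<close> outside the stated
  interval is a deviation of the mean by at least \<open>ln (1 + \<epsilon>) / 2\<close>, which exceeds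
  \<open>\<epsilon> * (1 - \<epsilon>) / 2\<close>.  A union bound over the pairs of points finishes the proof.
\<close>

section \<open>Stability of the Cauchy distribution\<close>

text \<open>For a nonnegative integrand, finite limits of an antiderivative at both ends already
  give absolute integrability on the whole line. This evaluates both the convolution integral and
  the total mass of \<open>cauchy\<close>.\<close>

lemma nn_integral_FTC_real:
  fixes f F :: "real \<Rightarrow> real"
  assumes F: "\<And>x. (F has_real_derivative f x) (at x)" and cont: "\<And>x. isCont f x"
    and nonneg: "\<And>x. 0 \<le> f x"
    and lims: "(F \<longlongrightarrow> A) at_bot" "(F \<longlongrightarrow> B) at_top"
  shows "(\<integral>\<^sup>+x. ennreal (f x) \<partial>lborel) = ennreal (B - A)"
proof -
  have *: "((F \<circ> real_of_ereal) \<longlongrightarrow> A) (at_right (-\<infinity>))" "((F \<circ> real_of_ereal) \<longlongrightarrow> B) (at_left \<infinity>)"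
    using lims by (simp_all add: ereal_tendsto_simps1)
  note FTC = interval_integral_FTC_nonneg[of "-\<infinity>" \<infinity> F f A B, OF _ F cont _ *]
  have "set_integrable lborel (einterval (-\<infinity>) \<infinity>) f" "(LBINT x=-\<infinity>..\<infinity>. f x) = B - A"
    using FTC nonneg by auto
  then show "(\<integral>\<^sup>+x. ennreal (f x) \<partial>lborel) = ennreal (B - A)"
    by (auto simp: set_integrable_def interval_lebesgue_integral_def set_lebesgue_integral_def
        einterval_def nn_integral_eq_integral nonneg)
qed

text \<open>For \<open>a > 0\<close> this is the density of the Cauchy law with scale
  \<open>a\<close>, also known as the Poisson kernel of the upper half-plane at height
  \<open>a\<close>. These kernels form a convolution semigroup in \<open>a\<close>.\<close>

definition cauchy_scaled :: "real \<Rightarrow> real \<Rightarrow> real" where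
  "cauchy_scaled a x = a / (pi * (a\<^sup>2 + x\<^sup>2))"

lemma cauchy_scaled_nonneg: "0 \<le> a \<Longrightarrow> 0 \<le> cauchy_scaled a x"
  by (simp add: cauchy_scaled_def)

lemma arctan_scaled_tendsto:
  fixes a z :: real
  assumes "a > 0"
  shows "((\<lambda>y. arctan ((y - z) / a)) \<longlongrightarrow> - (pi / 2)) at_bot"
    and "((\<lambda>y. arctan ((y - z) / a)) \<longlongrightarrow> pi / 2) at_top"
  using assms by real_asymp+

text \<open>Both quadratics have leading coefficient 1, so their quotient tends to 1. Hence the
  logarithmic part of the antiderivative contributes nothing to the convolution integral.\<close>

lemma ln_quotient_tendsto:
  fixes a b z :: real
  assumes "a > 0" "b > 0"
  shows "((\<lambda>y. ln ((b\<^sup>2 + y\<^sup>2) / (a\<^sup>2 + (y - z)\<^sup>2))) \<longlongrightarrow> 0) at_bot"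
    and "((\<lambda>y. ln ((b\<^sup>2 + y\<^sup>2) / (a\<^sup>2 + (y - z)\<^sup>2))) \<longlongrightarrow> 0) at_top"
proof -
  have "((\<lambda>y. ((b\<^sup>2 + y\<^sup>2) / (a\<^sup>2 + (y - z)\<^sup>2))) \<longlongrightarrow> 1) at_bot"
    "((\<lambda>y. ((b\<^sup>2 + y\<^sup>2) / (a\<^sup>2 + (y - z)\<^sup>2))) \<longlongrightarrow> 1) at_top"
    by real_asymp+
  then show "((\<lambda>y. ln ((b\<^sup>2 + y\<^sup>2) / (a\<^sup>2 + (y - z)\<^sup>2))) \<longlongrightarrow> 0) at_bot"
    and "((\<lambda>y. ln ((b\<^sup>2 + y\<^sup>2) / (a\<^sup>2 + (y - z)\<^sup>2))) \<longlongrightarrow> 0) at_top"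
    using tendsto_ln[of _ 1] by fastforce+
qed

text \<open>Partial fractions in \<open>y\<close>.  The common denominator \<open>D\<close> vanishes for \<open>a = b\<close>, \<open>z = 0\<close>; since
  densities only matter almost everywhere, excluding \<open>z = 0\<close> is harmless.\<close>

lemma cauchy_product_antiderivative:
  fixes a b z y :: real
  assumes "a > 0" "b > 0" "z \<noteq> 0"
  defines "D \<equiv> ((a + b)\<^sup>2 + z\<^sup>2) * ((a - b)\<^sup>2 + z\<^sup>2)"
  shows "((\<lambda>y. (a * b * z * ln ((b\<^sup>2 + y\<^sup>2) / (a\<^sup>2 + (y - z)\<^sup>2)) +
            a * (a\<^sup>2 - b\<^sup>2 + z\<^sup>2) * arctan (y / b) + b * (b\<^sup>2 - a\<^sup>2 + z\<^sup>2) * arctan ((y - z) / a)) / (pi\<^sup>2 * D))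
      has_real_derivative cauchy_scaled a (z - y) * cauchy_scaled b y) (at y)"
proof -
  define p q where "p = b\<^sup>2 + y\<^sup>2" and "q = a\<^sup>2 + (y - z)\<^sup>2"
  have pos: "p > 0" "q > 0" "D > 0"
    using assms by (auto simp: p_def q_def D_def sum_power2_gt_zero_iff intro!: mult_pos_pos)
  have 1: "((\<lambda>y. ln ((b\<^sup>2 + y\<^sup>2) / (a\<^sup>2 + (y - z)\<^sup>2))) has_real_derivative (2 * y / p - 2 * (y - z) / q)) (at y)"
    using pos unfolding p_def q_def
    by (auto intro!: derivative_eq_intros simp: divide_simps)
  have 2: "((\<lambda>y. arctan (y / b)) has_real_derivative b / p) (at y)"
    using assms pos unfolding p_def
    by (auto intro!: derivative_eq_intros simp: divide_simps power2_eq_square)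
  have 3: "((\<lambda>y. arctan ((y - z) / a)) has_real_derivative a / q) (at y)"
    using assms pos unfolding q_def
    by (auto intro!: derivative_eq_intros simp: divide_simps power2_eq_square)
  \<comment> \<open>Divided by \<open>p * q\<close>, this is the partial fraction decomposition of
    \<open>D / (p * q)\<close> with linear numerators over \<open>p\<close> and
    \<open>q\<close>.\<close>
  have alg: "(2 * y * z + (a\<^sup>2 - b\<^sup>2 + z\<^sup>2)) * q + (- 2 * (y - z) * z + (b\<^sup>2 - a\<^sup>2 + z\<^sup>2)) * p = D"
    unfolding p_def q_def D_def by algebra
  have "(a * b * z * (2 * y / p - 2 * (y - z) / q) + a * (a\<^sup>2 - b\<^sup>2 + z\<^sup>2) * (b / p) +
           b * (b\<^sup>2 - a\<^sup>2 + z\<^sup>2) * (a / q)) =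
        a * b * ((2 * y * z + (a\<^sup>2 - b\<^sup>2 + z\<^sup>2)) * q + (- 2 * (y - z) * z + (b\<^sup>2 - a\<^sup>2 + z\<^sup>2)) * p) / (p * q)"
    using pos by (simp add: divide_simps) algebra
  also have "\<dots> = a * b * D / (p * q)" unfolding alg ..
  finally have 4: "(a * b * z * (2 * y / p - 2 * (y - z) / q) + a * (a\<^sup>2 - b\<^sup>2 + z\<^sup>2) * (b / p) +
           b * (b\<^sup>2 - a\<^sup>2 + z\<^sup>2) * (a / q)) / (pi\<^sup>2 * D) = cauchy_scaled a (z - y) * cauchy_scaled b y"
    using pos unfolding cauchy_scaled_def p_def[symmetric] power2_commute[of z y] q_def[symmetric]
    by (simp add: divide_simps power2_eq_square)
  show ?thesis
    unfolding 4[symmetric]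
    by (intro DERIV_cdivide DERIV_add DERIV_cmult 1 2 3)
qed

text \<open>The logarithm vanishes at both ends and each arctangent increases by pi. The two
  arctangent coefficients add up to \<open>(a + b) * ((a - b)\<^sup>2 + z\<^sup>2)\<close>, whose
  second factor cancels against \<open>D\<close>.\<close>

lemma cauchy_scaled_convolution:
  assumes "a > 0" "b > 0" "z \<noteq> 0"
  shows "(\<integral>\<^sup>+y. ennreal (cauchy_scaled a (z - y) * cauchy_scaled b y) \<partial>lborel) = ennreal (cauchy_scaled (a + b) z)"
proof -
  define D where "D = ((a + b)\<^sup>2 + z\<^sup>2) * ((a - b)\<^sup>2 + z\<^sup>2)"
  have pos: "a\<^sup>2 + (z - y)\<^sup>2 \<noteq> 0" "b\<^sup>2 + y\<^sup>2 \<noteq> 0" for y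
    using assms by (simp_all add: sum_power2_eq_zero_iff)
  have ar: "((\<lambda>y. arctan (y / b)) \<longlongrightarrow> - (pi / 2)) at_bot" "((\<lambda>y. arctan (y / b)) \<longlongrightarrow> pi / 2) at_top"
    using arctan_scaled_tendsto[OF assms(2), of 0] by simp_all
  let ?G = "\<lambda>y. (a * b * z * ln ((b\<^sup>2 + y\<^sup>2) / (a\<^sup>2 + (y - z)\<^sup>2)) +
    a * (a\<^sup>2 - b\<^sup>2 + z\<^sup>2) * arctan (y / b) + b * (b\<^sup>2 - a\<^sup>2 + z\<^sup>2) * arctan ((y - z) / a)) / (pi\<^sup>2 * D)"
  let ?L = "\<lambda>t. (a * b * z * 0 + a * (a\<^sup>2 - b\<^sup>2 + z\<^sup>2) * t + b * (b\<^sup>2 - a\<^sup>2 + z\<^sup>2) * t) / (pi\<^sup>2 * D)"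
  have nz: "(a + b)\<^sup>2 + z\<^sup>2 \<noteq> 0" "(a - b)\<^sup>2 + z\<^sup>2 \<noteq> 0"
    using assms by (simp_all add: sum_power2_eq_zero_iff)
  then have "pi\<^sup>2 * D \<noteq> 0" by (simp add: D_def)
  then have lims: "(?G \<longlongrightarrow> ?L (- (pi / 2))) at_bot" "(?G \<longlongrightarrow> ?L (pi / 2)) at_top"
    using assms by (intro tendsto_intros ln_quotient_tendsto arctan_scaled_tendsto ar; simp)+
  have cont: "isCont (\<lambda>y. cauchy_scaled a (z - y) * cauchy_scaled b y) y" for y
    unfolding cauchy_scaled_def using pos by (intro continuous_intros) auto
  have nonneg: "0 \<le> cauchy_scaled a (z - y) * cauchy_scaled b y" for y
    using assms by (simp add: cauchy_scaled_nonneg)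
  have eq: "(\<integral>\<^sup>+y. ennreal (cauchy_scaled a (z - y) * cauchy_scaled b y) \<partial>lborel) =
    ennreal (?L (pi / 2) - ?L (- (pi / 2)))"
    by (rule nn_integral_FTC_real[OF cauchy_product_antiderivative[OF assms, folded D_def] cont nonneg lims])
  have "a * (a\<^sup>2 - b\<^sup>2 + z\<^sup>2) + b * (b\<^sup>2 - a\<^sup>2 + z\<^sup>2) = (a + b) * ((a - b)\<^sup>2 + z\<^sup>2)"
    by algebra
  moreover have "?L (pi / 2) - ?L (- (pi / 2)) =
      pi * (a * (a\<^sup>2 - b\<^sup>2 + z\<^sup>2) + b * (b\<^sup>2 - a\<^sup>2 + z\<^sup>2)) / (pi\<^sup>2 * D)"
    unfolding diff_divide_distrib[symmetric] by (simp add: algebra_simps)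
  ultimately have "?L (pi / 2) - ?L (- (pi / 2)) = pi * ((a + b) * ((a - b)\<^sup>2 + z\<^sup>2)) / (pi\<^sup>2 * D)"
    by (simp only:)
  moreover have "pi * (s * v) / (pi\<^sup>2 * (u * v)) = s / (pi * u)" if "v \<noteq> 0" for s u v :: real
    using that by (simp add: power2_eq_square)
  ultimately have "?L (pi / 2) - ?L (- (pi / 2)) = cauchy_scaled (a + b) z"
    using nz(2) unfolding D_def cauchy_scaled_def by metis
  then show ?thesis using eq by simp
qed

lemma cauchy_scaled_measurable [measurable]: "cauchy_scaled a \<in> borel_measurable borel"
  unfolding cauchy_scaled_def by measurable

lemma cauchy_density_eq_scaled: "cauchy_density = cauchy_scaled 1"
  by (simp add: fun_eq_iff cauchy_density_def cauchy_scaled_def)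

section \<open>Sums, multiples and linear combinations of independent Cauchy variables\<close>

context prob_space
begin

lemma add_indep_cauchy:
  assumes indep: "indep_var borel X borel Y" and pos: "a > 0" "b > 0"
    and X: "distributed M lborel X (cauchy_scaled a)"
    and Y: "distributed M lborel Y (cauchy_scaled b)"
  shows "distributed M lborel (\<lambda>\<omega>. X \<omega> + Y \<omega>) (cauchy_scaled (a + b))"
proof -
  have "AE z in lborel. (\<integral>\<^sup>+y. ennreal (cauchy_scaled a (z - y)) * ennreal (cauchy_scaled b y) \<partial>lborel) =
      ennreal (cauchy_scaled (a + b) z)"
    using AE_lborel_singleton[of 0]
    by eventually_elim
      (simp add: cauchy_scaled_convolution[OF pos] ennreal_mult'[symmetric] cauchy_scaled_nonneg pos less_imp_le)
  then show ?thesis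
    using distributed_convolution[OF indep X Y] by (subst distributed_cong_density[symmetric]) auto
qed

lemma sum_indep_cauchy:
  assumes "finite I" "I \<noteq> {}" "indep_vars (\<lambda>i. borel) X I"
    and "\<And>i. i \<in> I \<Longrightarrow> 0 < a i"
    and "\<And>i. i \<in> I \<Longrightarrow> distributed M lborel (X i) (cauchy_scaled (a i))"
  shows "distributed M lborel (\<lambda>\<omega>. \<Sum>i\<in>I. X i \<omega>) (cauchy_scaled (\<Sum>i\<in>I. a i))"
  using assms
proof (induct I rule: finite_ne_induct)
  case (insert i I)
  have "distributed M lborel (\<lambda>\<omega>. X i \<omega> + (\<Sum>i\<in>I. X i \<omega>)) (cauchy_scaled (a i + sum a I))"
  proof (intro add_indep_cauchy indep_vars_sum insert)
    show "0 < sum a I" using insert by (intro sum_pos) auto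
    show "indep_vars (\<lambda>i. borel) X I" using insert by (auto intro: indep_vars_subset)
  qed (use insert in auto)
  then show ?case using insert by simp
qed simp

lemma scale_cauchy:
  assumes X: "distributed M lborel X (cauchy_scaled a)" and c: "c \<noteq> 0" and a: "a > 0"
  shows "distributed M lborel (\<lambda>\<omega>. c * X \<omega>) (cauchy_scaled (\<bar>c\<bar> * a))"
proof -
  have "cauchy_scaled a (x / c) / \<bar>c\<bar> = cauchy_scaled (\<bar>c\<bar> * a) x" for x
  proof -
    have "a\<^sup>2 + (x / c)\<^sup>2 = ((\<bar>c\<bar> * a)\<^sup>2 + x\<^sup>2) / \<bar>c\<bar>\<^sup>2"
      using c by (simp add: power_divide power_mult_distrib field_simps)
    moreover have "(\<bar>c\<bar> * a)\<^sup>2 + x\<^sup>2 > 0"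
      using c a unfolding sum_power2_gt_zero_iff by simp
    moreover have "a / (pi * (r / k\<^sup>2)) / k = k * a / (pi * r)" if "r > 0" "k > 0" for r k :: real
      using that by (simp add: divide_simps power2_eq_square)
    ultimately show ?thesis
      using c unfolding cauchy_scaled_def by (metis zero_less_abs_iff)
  qed
  then have "ennreal (cauchy_scaled a (x / c)) / ennreal \<bar>c\<bar> = ennreal (cauchy_scaled (\<bar>c\<bar> * a) x)" for x
    using c a by (subst divide_ennreal) (auto simp: cauchy_scaled_nonneg)
  then show ?thesis
    using distributed_affine[OF X c, of 0] by simp
qed

text \<open>1-stability: the scales \<bar>w i\<bar> of the summands add, so dividing by their total
  restores scale 1.\<close>

lemma linear_combination_cauchy:
  fixes X :: "'i \<Rightarrow> 'a \<Rightarrow> real" and w :: "'i \<Rightarrow> real"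
  assumes "finite J" and indep: "indep_vars (\<lambda>_. borel) X J"
    and X: "\<And>i. i \<in> J \<Longrightarrow> distributed M lborel (X i) cauchy_density"
    and w: "(\<Sum>i\<in>J. \<bar>w i\<bar>) > 0"
  shows "distributed M lborel (\<lambda>\<omega>. (\<Sum>i\<in>J. w i * X i \<omega>) / (\<Sum>i\<in>J. \<bar>w i\<bar>)) cauchy_density"
proof -
  let ?l = "\<Sum>i\<in>J. \<bar>w i\<bar>"
  \<comment> \<open>A summand with zero weight is constant and has no density, so it is dropped.
    Something remains because the weights have positive total.\<close>
  define I where "I = {i \<in> J. w i \<noteq> 0}"
  have I: "finite I" "I \<subseteq> J" using \<open>finite J\<close> by (auto simp: I_def)
  have sum_I: "(\<Sum>i\<in>I. w i * X i \<omega>) = (\<Sum>i\<in>J. w i * X i \<omega>)" for \<omega>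
    using \<open>finite J\<close> by (intro sum.mono_neutral_left) (auto simp: I_def)
  have sum_w: "(\<Sum>i\<in>I. \<bar>w i\<bar>) = ?l"
    using \<open>finite J\<close> by (intro sum.mono_neutral_left) (auto simp: I_def)
  have "I \<noteq> {}" using w sum_w by auto
  moreover have "indep_vars (\<lambda>_. borel) (\<lambda>i \<omega>. w i * X i \<omega>) I"
    using indep_vars_subset[OF indep I(2)] by (rule indep_vars_compose2[where Y = "\<lambda>i x. w i * x"]) auto
  moreover have "distributed M lborel (\<lambda>\<omega>. w i * X i \<omega>) (cauchy_scaled \<bar>w i\<bar>)" if "i \<in> I" for i
    using scale_cauchy[OF X[of i, unfolded cauchy_density_eq_scaled], of "w i"] that by (simp add: I_def)
  ultimately have "distributed M lborel (\<lambda>\<omega>. \<Sum>i\<in>I. w i * X i \<omega>) (cauchy_scaled (\<Sum>i\<in>I. \<bar>w i\<bar>))"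
    using I(1) by (intro sum_indep_cauchy) (auto simp: I_def)
  then have "distributed M lborel (\<lambda>\<omega>. \<Sum>i\<in>J. w i * X i \<omega>) (cauchy_scaled ?l)"
    by (simp only: sum_I sum_w)
  from scale_cauchy[OF this, of "1 / ?l"] w show ?thesis
    by (simp add: cauchy_density_eq_scaled)
qed

end

section \<open>Integration against the Cauchy distribution\<close>

lemma cauchy_density_pos: "0 < cauchy_density x"
  by (simp add: cauchy_density_def add_pos_nonneg)

lemma cauchy_density_nonneg [simp]: "0 \<le> cauchy_density x"
  using cauchy_density_pos[of x] by simp

lemma cauchy_density_measurable [measurable]: "cauchy_density \<in> borel_measurable borel"
  unfolding cauchy_density_def by measurable

lemma sets_cauchy [simp, measurable_cong]: "sets cauchy = sets borel"
  by (simp add: cauchy_def)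

lemma space_cauchy [simp]: "space cauchy = UNIV"
  by (simp add: cauchy_def)

lemma integrable_cauchy_iff:
  fixes h :: "real \<Rightarrow> real"
  assumes "h \<in> borel_measurable borel"
  shows "integrable cauchy h \<longleftrightarrow> integrable lborel (\<lambda>x. cauchy_density x * h x)"
  using assms unfolding cauchy_def by (subst integrable_density) auto

lemma integral_cauchy:
  fixes h :: "real \<Rightarrow> real"
  assumes "h \<in> borel_measurable borel"
  shows "(\<integral>x. h x \<partial>cauchy) = (\<integral>x. cauchy_density x * h x \<partial>lborel)"
  using assms unfolding cauchy_def by (subst integral_density) auto

lemma AE_cauchy_nonzero: "AE x in cauchy. x \<noteq> 0"
  unfolding cauchy_def using AE_lborel_singleton[of 0] by (subst AE_density) auto

lemma prob_space_cauchy: "prob_space cauchy"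
proof
  have "(\<integral>\<^sup>+x. ennreal (cauchy_density x) \<partial>lborel) = ennreal (pi / 2 / pi - (- (pi / 2)) / pi)"
  proof (rule nn_integral_FTC_real[where F = "\<lambda>x. arctan x / pi"])
    show "((\<lambda>x. arctan x / pi) has_real_derivative cauchy_density x) (at x)" for x
      unfolding cauchy_density_def
      by (rule DERIV_cong, rule DERIV_cdivide, rule DERIV_arctan) (simp add: divide_simps)
    show "isCont cauchy_density x" for x
      unfolding cauchy_density_def
      by (intro continuous_intros) (simp add: add_nonneg_eq_0_iff)
    show "((\<lambda>x. arctan x / pi) \<longlongrightarrow> - (pi / 2) / pi) at_bot"
      by (intro tendsto_intros tendsto_arctan_at_bot) simp
    show "((\<lambda>x. arctan x / pi) \<longlongrightarrow> pi / 2 / pi) at_top"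
      by (intro tendsto_intros tendsto_arctan_at_top) simp
  qed simp
  then show "emeasure cauchy (space cauchy) = 1"
    by (simp add: cauchy_def emeasure_density)
qed

interpretation cauchy: prob_space cauchy
  by (rule prob_space_cauchy)

text \<open>Substitution: the Jacobian of \<open>inverse\<close> turns
  \<open>cauchy_density (inverse x)\<close> back into \<open>cauchy_density x\<close>.\<close>

lemma
  fixes h :: "real \<Rightarrow> real"
  assumes int: "integrable cauchy h"
  shows integrable_cauchy_inverse: "integrable cauchy (\<lambda>x. h (inverse x))"
    and integral_cauchy_inverse: "(\<integral>x. h (inverse x) \<partial>cauchy) = (\<integral>x. h x \<partial>cauchy)"
proof -
  have [measurable]: "h \<in> borel_measurable borel"
    using borel_measurable_integrable[OF int] by simp
  let ?f = "\<lambda>x. cauchy_density x * h x" and ?g = "\<lambda>x. cauchy_density x * h (inverse x)"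
  \<comment> \<open>\<open>inverse\<close> is differentiable only away from 0. Removing that null
    point, and passing from \<open>lborel\<close> to its completion \<open>lebesgue\<close>, changes
    no integral; \<open>conv\<close> records this.\<close>
  let ?S = "- {0 :: real}"
  have conv: "integrable lebesgue (\<lambda>x. indicator ?S x *\<^sub>R u x) \<longleftrightarrow> integrable lborel u"
      "(\<integral>x. indicator ?S x *\<^sub>R u x \<partial>lebesgue) = (\<integral>x. u x \<partial>lborel)"
    if [measurable]: "u \<in> borel_measurable borel" for u :: "real \<Rightarrow> real"
  proof -
    have ae: "AE x in lborel. indicator ?S x *\<^sub>R u x = u x"
      using AE_lborel_singleton[of 0] by eventually_elim simp
    have "integrable lborel (\<lambda>x. indicator ?S x *\<^sub>R u x) \<longleftrightarrow> integrable lborel u"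
      by (rule integrable_cong_AE[OF _ _ ae]) measurable
    then show "integrable lebesgue (\<lambda>x. indicator ?S x *\<^sub>R u x) \<longleftrightarrow> integrable lborel u"
      by (simp add: integrable_completion)
    have "(\<integral>x. indicator ?S x *\<^sub>R u x \<partial>lborel) = (\<integral>x. u x \<partial>lborel)"
      by (rule integral_cong_AE[OF _ _ ae]) measurable
    then show "(\<integral>x. indicator ?S x *\<^sub>R u x \<partial>lebesgue) = (\<integral>x. u x \<partial>lborel)"
      by (simp add: integral_completion)
  qed
  have img: "inverse ` ?S = ?S"
    by (auto intro: image_eqI[where x = "inverse _"])
  have weight: "\<bar>- (inverse x * inverse x)\<bar> * ?f (inverse x) = ?g x" if "x \<in> ?S" for x
  proof -
    have "1 + (inverse x)\<^sup>2 = (1 + x\<^sup>2) / x\<^sup>2" "1 + x\<^sup>2 > 0"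
      using that by (auto simp: field_simps power2_eq_square add_pos_nonneg)
    then show ?thesis
      using that unfolding cauchy_density_def by (simp add: abs_mult divide_simps power2_eq_square)
  qed
  have f_int: "?f absolutely_integrable_on ?S"
    using int unfolding set_integrable_def by (subst conv) (auto simp: integrable_cauchy_iff)
  have "(\<lambda>x. \<bar>- (inverse x * inverse x)\<bar> * ?f (inverse x)) absolutely_integrable_on ?S \<and>
      integral ?S (\<lambda>x. \<bar>- (inverse x * inverse x)\<bar> * ?f (inverse x)) = integral ?S ?f"
    using f_int by (subst has_absolute_integral_change_of_variables_1'[where f = ?f and g = inverse])
      (auto simp: img inj_on_def intro!: derivative_eq_intros)
  also have "(\<lambda>x. \<bar>- (inverse x * inverse x)\<bar> * ?f (inverse x)) absolutely_integrable_on ?S \<longleftrightarrow>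
      ?g absolutely_integrable_on ?S"
    using weight by (intro set_integrable_cong) auto
  also have "integral ?S (\<lambda>x. \<bar>- (inverse x * inverse x)\<bar> * ?f (inverse x)) = integral ?S ?g"
    using weight by (intro integral_cong) auto
  finally have g: "?g absolutely_integrable_on ?S" "integral ?S ?g = integral ?S ?f" by auto
  show "integrable cauchy (\<lambda>x. h (inverse x))"
    using g(1) unfolding set_integrable_def by (subst (asm) conv) (auto simp: integrable_cauchy_iff)
  have "(\<integral>x. ?g x \<partial>lborel) = (\<integral>x. ?f x \<partial>lborel)"
    using g(2) set_lebesgue_integral_eq_integral(2)[OF g(1)] set_lebesgue_integral_eq_integral(2)[OF f_int]
      conv(2)[of ?f] conv(2)[of ?g]
    unfolding set_lebesgue_integral_def by auto
  then show "(\<integral>x. h (inverse x) \<partial>cauchy) = (\<integral>x. h x \<partial>cauchy)"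
    by (simp add: integral_cauchy)
qed

text \<open>With \<open>u = sqrt (2 * x)\<close> the denominator becomes \<open>4 + u ^ 4\<close>,
  which factors as \<open>(1 + (u + 1)\<^sup>2) * (1 + (u - 1)\<^sup>2)\<close>. Adding the moments
  of order 1/2 and -1/2 makes the numerator the sum of these factors, so only arctangents
  appear.\<close>

lemma sqrt_moment_antiderivative:
  fixes x :: real
  assumes "x > 0"
  shows "((\<lambda>x. sqrt 2 / pi * (arctan (sqrt (2 * x) + 1) + arctan (sqrt (2 * x) - 1)))
    has_real_derivative cauchy_density x * (sqrt \<bar>x\<bar> + 1 / sqrt \<bar>x\<bar>)) (at x)"
proof -
  define u where "u = sqrt (2 * x)"
  have u: "u > 0" "x = u\<^sup>2 / 2" using assms by (auto simp: u_def)
  have pos: "1 + (u + 1)\<^sup>2 > 0" "1 + (u - 1)\<^sup>2 > 0" "4 + u ^ 4 > 0" by (simp_all add: add_pos_nonneg)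
  have "(1 + (u + 1)\<^sup>2) * (1 + (u - 1)\<^sup>2) = 4 + u ^ 4" by algebra
  then have frac: "1 / (1 + (u + 1)\<^sup>2) + 1 / (1 + (u - 1)\<^sup>2) = (2 * u\<^sup>2 + 4) / (4 + u ^ 4)"
    using pos by (subst add_frac_eq) (simp, simp, simp add: power2_sum power2_diff)
  have sqrt_x: "sqrt \<bar>x\<bar> = u / sqrt 2"
    using assms by (simp add: u_def real_sqrt_mult)
  have sq_x: "x\<^sup>2 = u ^ 4 / 4"
    unfolding u(2) by (simp add: power2_eq_square power4_eq_xxxx)
  have dens: "cauchy_density x * (sqrt \<bar>x\<bar> + 1 / sqrt \<bar>x\<bar>) = sqrt 2 / pi * ((2 * u\<^sup>2 + 4) / (4 + u ^ 4) * (1 / u))"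
  proof -
    have "u / sqrt 2 + 1 / (u / sqrt 2) = (u\<^sup>2 + (sqrt 2)\<^sup>2) / (sqrt 2 * u)"
      using u(1) by (simp add: add_frac_eq power2_eq_square del: real_sqrt_pow2 real_sqrt_mult_self)
    also have "\<dots> = sqrt 2 * (u\<^sup>2 + 2) / ((sqrt 2)\<^sup>2 * u)"
    proof -
      have "v / (r * u) = r * v / (r\<^sup>2 * u)" if "r > 0" for r v :: real
        using that by (simp add: power2_eq_square)
      from this[of "sqrt 2"] show ?thesis by simp
    qed
    finally have "u / sqrt 2 + 1 / (u / sqrt 2) = sqrt 2 * (u\<^sup>2 + 2) / (2 * u)" by simp
    moreover have "1 + u ^ 4 / 4 = (4 + u ^ 4) / 4" by simp
    moreover have "1 / (pi * (w / 4)) * (r * v / (2 * u)) = r / pi * ((2 * v) / w * (1 / u))"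
      if "w > 0" for w r v :: real
      using that u(1) by (simp add: divide_simps)
    moreover have "2 * u\<^sup>2 + 4 = 2 * (u\<^sup>2 + 2)" by simp
    ultimately show ?thesis
      using pos(3) unfolding cauchy_density_def sqrt_x sq_x by metis
  qed
  have 1: "((\<lambda>x. sqrt (2 * x)) has_real_derivative 1 / u) (at x)"
    using assms by (auto intro!: derivative_eq_intros simp: u_def field_simps)
  have 2: "((\<lambda>x. arctan (sqrt (2 * x) + e)) has_real_derivative 1 / (1 + (u + e)\<^sup>2) * (1 / u)) (at x)" for e
    by (rule DERIV_cong[OF DERIV_chain2[OF DERIV_arctan DERIV_add[OF 1 DERIV_const[of e]]]])
      (simp add: u_def inverse_eq_divide)
  have "((\<lambda>x. sqrt 2 / pi * (arctan (sqrt (2 * x) + 1) + arctan (sqrt (2 * x) - 1)))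
    has_real_derivative sqrt 2 / pi * ((1 / (1 + (u + 1)\<^sup>2) + 1 / (1 + (u - 1)\<^sup>2)) * (1 / u))) (at x)"
    using DERIV_cmult[OF DERIV_add[OF 2[of 1] 2[of "-1"]], of "sqrt 2 / pi"]
    by (simp only: distrib_right diff_conv_add_uminus)
  then show ?thesis unfolding frac dens .
qed

text \<open>On the positive half-line the integral is \<open>sqrt 2\<close>: at 0 the values arctan
  1 and arctan (-1) cancel, and at infinity both arctangents tend to pi / 2. Evenness doubles
  it.\<close>

lemma cauchy_sqrt_moment:
  "has_bochner_integral cauchy (\<lambda>x. sqrt \<bar>x\<bar> + 1 / sqrt \<bar>x\<bar>) (2 * sqrt 2)"
proof -
  let ?h = "\<lambda>x :: real. sqrt \<bar>x\<bar> + 1 / sqrt \<bar>x\<bar>"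
  let ?f = "\<lambda>x. cauchy_density x * ?h x"
  let ?F = "\<lambda>x. sqrt 2 / pi * (arctan (sqrt (2 * x) + 1) + arctan (sqrt (2 * x) - 1))"
  have [measurable]: "?h \<in> borel_measurable borel" by measurable
  have cont: "isCont ?f x" if "x > 0" for x
    unfolding cauchy_density_def using that
    by (intro continuous_intros) (auto simp: add_nonneg_eq_0_iff)
  have "isCont ?F 0" by (intro continuous_intros)
  then have "(?F \<longlongrightarrow> ?F 0) (at_right 0)"
    unfolding isCont_def filterlim_at_split by blast
  then have lim0: "(?F \<longlongrightarrow> 0) (at_right 0)"
    by (simp add: arctan_minus)
  have sq: "filterlim (\<lambda>x::real. sqrt (2 * x) + 1) at_top at_top" "filterlim (\<lambda>x::real. sqrt (2 * x) - 1) at_top at_top"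
    by real_asymp+
  have "(?F \<longlongrightarrow> sqrt 2 / pi * (pi / 2 + pi / 2)) at_top"
    by (intro tendsto_intros filterlim_compose[OF tendsto_arctan_at_top] sq)
  then have lim_top: "(?F \<longlongrightarrow> sqrt 2) at_top" by simp
  have lims: "((?F \<circ> real_of_ereal) \<longlongrightarrow> 0) (at_right 0)" "((?F \<circ> real_of_ereal) \<longlongrightarrow> sqrt 2) (at_left \<infinity>)"
    unfolding zero_ereal_def ereal_tendsto_simps1 by (rule lim0) (rule lim_top)
  have deriv: "(?F has_real_derivative ?f x) (at x)" if "0 < ereal x" "ereal x < \<infinity>" for x
    using that by (intro sqrt_moment_antiderivative) simp
  have cont': "isCont ?f x" if "0 < ereal x" "ereal x < \<infinity>" for x
    using that by (intro cont) simp
  have nonneg: "AE x in lborel. 0 < ereal x \<longrightarrow> ereal x < \<infinity> \<longrightarrow> 0 \<le> ?f x"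
    by (intro AE_I2 impI mult_nonneg_nonneg add_nonneg_nonneg) simp_all
  have "set_integrable lborel (einterval 0 \<infinity>) ?f" "(LBINT x=0..\<infinity>. ?f x) = sqrt 2 - 0"
    using interval_integral_FTC_nonneg[of 0 \<infinity> ?F ?f, OF _ deriv cont' nonneg lims] by simp_all
  then have "has_bochner_integral lborel (\<lambda>x. indicator {0<..} x *\<^sub>R ?f x) (sqrt 2)"
    by (simp add: has_bochner_integral_iff set_integrable_def interval_lebesgue_integral_def
        set_lebesgue_integral_def einterval_def greaterThan_def)
  \<comment> \<open>Including the endpoint changes nothing, because \<open>?f 0 = 0\<close> by the
    convention \<open>1 / 0 = 0\<close>.\<close>
  moreover have "(\<lambda>x. indicator {0<..} x *\<^sub>R ?f x) = (\<lambda>x. indicator {0..} x *\<^sub>R ?f x)"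
    by (auto simp: fun_eq_iff indicator_def)
  ultimately have "has_bochner_integral lborel ?f (2 *\<^sub>R sqrt 2)"
    by (intro has_bochner_integral_even_function) (auto simp: cauchy_density_def)
  then show ?thesis
    by (simp add: has_bochner_integral_iff integrable_cauchy_iff integral_cauchy)
qed

section \<open>Increments and exponential moments of xi\<close>

lemma exp_le_quadratic_exp_abs: "exp z \<le> 1 + z + z\<^sup>2 / 2 * exp \<bar>z\<bar>" for z :: real
proof -
  obtain t where t: "\<bar>t\<bar> \<le> \<bar>z\<bar>" "exp z = (\<Sum>m<2. z ^ m / fact m) + exp t / fact 2 * z ^ 2"
    using Maclaurin_exp_le by blast
  have "exp t / 2 * z\<^sup>2 \<le> exp \<bar>z\<bar> / 2 * z\<^sup>2"
    using t(1) by (intro mult_right_mono) auto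
  then show ?thesis using t(2) by (simp add: numeral_2_eq_2 field_simps)
qed

text \<open>The constant is the maximum of z^2 exp (-z), attained at z = 2. It comes from squaring
  the tangent inequality z / 2 <= exp (z / 2 - 1).\<close>

lemma square_le_exp: "z\<^sup>2 \<le> 4 / (exp 1)\<^sup>2 * exp z" if "z \<ge> 0" for z :: real
proof -
  have "z / 2 \<le> exp (z / 2 - 1)"
    using exp_ge_add_one_self[of "z / 2 - 1"] by simp
  then have "(z / 2)\<^sup>2 \<le> (exp (z / 2 - 1))\<^sup>2"
    using that by (intro power_mono) auto
  also have "\<dots> = exp z / (exp 1)\<^sup>2"
    by (simp add: exp_diff power_divide exp_double[symmetric])
  finally show ?thesis by (simp add: power_divide field_simps)
qed

text \<open>The left side is the larger of \<open>sqrt x\<close> and \<open>1 / sqrt x\<close>;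
  bounding it by their sum leads to a moment that is known exactly.\<close>

lemma exp_half_abs_ln_le: "exp (\<bar>ln x\<bar> / 2) \<le> sqrt x + 1 / sqrt x" if "x > 0" for x :: real
proof -
  have *: "exp (ln x / 2) = sqrt x"
    using that by (simp add: ln_sqrt[symmetric])
  have "exp (\<bar>ln x\<bar> / 2) = sqrt x \<or> exp (\<bar>ln x\<bar> / 2) = 1 / sqrt x"
    using * by (cases "ln x \<ge> 0") (auto simp: exp_minus inverse_eq_divide)
  then show ?thesis using that by auto
qed

section \<open>Growth of \<open>xi\<close> and of its mean on a logarithmic scale\<close>

lemma xi_mono: "0 \<le> s \<Longrightarrow> s \<le> t \<Longrightarrow> xi s \<le> xi t"
  unfolding xi_def by (intro add_mono mult_left_mono ln_mono) (auto intro: add_pos_nonneg)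

lemma xi_measurable [measurable]: "xi \<in> borel_measurable borel"
  unfolding xi_def by measurable

text \<open>For \<open>t >= 1\<close> a factor \<open>sqrt t\<close> can be pulled out of
  \<open>1 + sqrt (l * t)\<close> and a factor \<open>t\<close> out of \<open>1 + l * t\<close>.
  Each of the two terms of \<open>xi\<close> then contributes \<open>ln t / 2\<close>.\<close>

lemma xi_mult_le: "xi (l * t) \<le> xi l + ln t" if "l \<ge> 0" "t \<ge> 1"
proof -
  have "ln (1 + sqrt (l * t)) \<le> ln ((1 + sqrt l) * sqrt t)"
    using that by (intro ln_mono) (auto simp: real_sqrt_mult algebra_simps add_pos_nonneg)
  also have "\<dots> = ln (1 + sqrt l) + ln t / 2"
    using that by (subst ln_mult_pos) (auto simp: ln_sqrt add_pos_nonneg)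
  finally have 1: "ln (1 + sqrt (l * t)) \<le> ln (1 + sqrt l) + ln t / 2" .
  have "ln (1 + l * t) \<le> ln ((1 + l) * t)"
    using that by (intro ln_mono) (auto simp: algebra_simps add_pos_nonneg)
  also have "\<dots> = ln (1 + l) + ln t"
    using that by (subst ln_mult_pos) auto
  finally show ?thesis using 1 unfolding xi_def by simp
qed

lemma abs_xi_diff_le: "\<bar>xi (l * t) - xi l\<bar> \<le> \<bar>ln t\<bar>" if "l \<ge> 0" "t > 0"
proof (cases "t \<ge> 1")
  case True
  then have "xi l \<le> xi (l * t)" using that by (intro xi_mono) (auto simp: mult_le_cancel_left1)
  then show ?thesis using xi_mult_le[of l t] that True by simp
next
  case False
  then have "xi (l * t) \<le> xi l" using that by (intro xi_mono) (auto simp: mult_le_cancel_left2)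
  \<comment> \<open>For \<open>t < 1\<close> the growth bound is run backwards: it starts at
    \<open>l * t\<close> and multiplies by \<open>1 / t\<close>.\<close>
  moreover have "xi (l * t * (1 / t)) \<le> xi (l * t) + ln (1 / t)"
    using that False by (intro xi_mult_le) auto
  ultimately show ?thesis using that False by (simp add: ln_div)
qed

text \<open>The pointwise form of \<open>mu b - mu a \<ge> ln (b / a) / 2\<close>: the law of \<open>\<bar>X\<bar>\<close> is invariant under
  inversion, so the increments at \<open>t\<close> and \<open>1 / t\<close> may be averaged.\<close>

lemma xi_symmetrized_increment:
  assumes ab: "0 < a" "a \<le> b" "1 \<le> a * b" and t: "t > 0"
  shows "ln (b / a) \<le> xi (b * t) - xi (a * t) + (xi (b / t) - xi (a / t))"
proof -
  \<comment> \<open>Used twice: at \<open>a\<close>, \<open>b\<close>, \<open>t\<close> for the term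
    \<open>ln (1 + t)\<close> of \<open>xi\<close>, and at their square roots for
    \<open>ln (1 + sqrt t)\<close>. Either use yields half of \<open>ln (b / a)\<close>.\<close>
  have key: "ln (q / p) \<le> ln (1 + q * s) - ln (1 + p * s) + (ln (1 + q / s) - ln (1 + p / s))"
    if "0 < p" "p \<le> q" "1 \<le> p * q" "s > 0" for p q s :: real
  proof -
    have pos: "0 < q" "1 + q * s > 0" "1 + p * s > 0" "s + q > 0" "s + p > 0"
      using that by (auto intro: add_pos_pos)
    \<comment> \<open>The cross-multiplied difference factors; its sign is where
      \<open>1 <= p * q\<close> enters.\<close>
    have "p * ((1 + q * s) * (s + q)) - q * ((1 + p * s) * (s + p)) = s * (q - p) * (p * q - 1)"
      by algebra
    also have "\<dots> \<ge> 0" using that by (intro mult_nonneg_nonneg) auto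
    finally have "q / p \<le> (1 + q * s) * (s + q) / ((1 + p * s) * (s + p))"
      using pos that by (simp add: divide_simps mult_ac)
    then have "ln (q / p) \<le> ln ((1 + q * s) * (s + q) / ((1 + p * s) * (s + p)))"
      using pos that by (intro ln_mono) auto
    also have "\<dots> = ln (1 + q * s) - ln (1 + p * s) + (ln (s + q) - ln (s + p))"
      using pos by (simp add: ln_div ln_mult_pos)
    also have "ln (s + q) - ln (s + p) = ln (1 + q / s) - ln (1 + p / s)"
    proof -
      have "1 + q / s = (s + q) / s" "1 + p / s = (s + p) / s" using that by (simp_all add: field_simps)
      then show ?thesis using pos that by (simp add: ln_div)
    qed
    finally show ?thesis .
  qed
  have "1 \<le> sqrt a * sqrt b"
    using ab by (simp add: real_sqrt_mult[symmetric])
  then have "ln (sqrt b / sqrt a) \<le> ln (1 + sqrt b * sqrt t) - ln (1 + sqrt a * sqrt t) +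
      (ln (1 + sqrt b / sqrt t) - ln (1 + sqrt a / sqrt t))"
    using ab t by (intro key) auto
  moreover have "ln (sqrt b / sqrt a) = ln (b / a) / 2"
    using ab by (simp add: ln_div ln_sqrt diff_divide_distrib)
  ultimately show ?thesis
    using key[OF ab t] unfolding xi_def
    by (simp add: real_sqrt_mult real_sqrt_divide field_simps)
qed

text \<open>From 1 + y <= exp y at y = \<bar>ln x\<bar> / 2. It supplies the integrable majorant for
  the increments of \<open>xi\<close>.\<close>

lemma abs_ln_le_sqrt: "\<bar>ln x\<bar> \<le> 2 * (sqrt x + 1 / sqrt x)" if "x > 0" for x :: real
proof -
  have "1 + \<bar>ln x\<bar> / 2 \<le> sqrt x + 1 / sqrt x"
    using exp_ge_add_one_self exp_half_abs_ln_le[OF that] by (rule order_trans)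
  then show ?thesis unfolding distrib_left by linarith
qed

lemma integrable_xi_diff: "integrable cauchy (\<lambda>x. xi (l * \<bar>x\<bar>) - xi l)" if "l \<ge> 0"
proof (rule Bochner_Integration.integrable_bound)
  show "integrable cauchy (\<lambda>x. 2 * (sqrt \<bar>x\<bar> + 1 / sqrt \<bar>x\<bar>))"
    using cauchy_sqrt_moment by (intro integrable_mult_right) (simp add: has_bochner_integral_iff)
  show "AE x in cauchy. norm (xi (l * \<bar>x\<bar>) - xi l) \<le> norm (2 * (sqrt \<bar>x\<bar> + 1 / sqrt \<bar>x\<bar>))"
    using AE_cauchy_nonzero
  proof eventually_elim
    case (elim x)
    then show ?case
      using abs_xi_diff_le[OF that, of "\<bar>x\<bar>"] abs_ln_le_sqrt[of "\<bar>x\<bar>"] by simp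
  qed
qed measurable

lemma integrable_xi: "integrable cauchy (\<lambda>x. xi (l * \<bar>x\<bar>))" if "l \<ge> 0"
  using Bochner_Integration.integrable_add[OF integrable_xi_diff[OF that] cauchy.integrable_const[of "xi l"]]
  by simp

text \<open>Integrate the symmetrized inequality. By inversion invariance the increment and its
  reflected copy have equal means, hence the factor 1/2.\<close>

lemma mu_increment:
  assumes "0 < a" "a \<le> b" "1 \<le> a * b"
  shows "mu b - mu a \<ge> ln (b / a) / 2"
proof -
  let ?d = "\<lambda>x. xi (b * \<bar>x\<bar>) - xi (a * \<bar>x\<bar>)"
  have d: "integrable cauchy ?d"
    using assms by (intro Bochner_Integration.integrable_diff integrable_xi) auto
  have "ln (b / a) = (\<integral>x. ln (b / a) \<partial>cauchy)"
    using cauchy.prob_space by simp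
  also have "\<dots> \<le> (\<integral>x. ?d x + ?d (inverse x) \<partial>cauchy)"
  proof (rule integral_mono_AE)
    show "AE x in cauchy. ln (b / a) \<le> ?d x + ?d (inverse x)"
      using AE_cauchy_nonzero
      by eventually_elim (use xi_symmetrized_increment[OF assms, of "\<bar>_\<bar>"] in
        \<open>simp add: abs_inverse divide_inverse\<close>)
  qed (use d integrable_cauchy_inverse[OF d] in auto)
  also have "\<dots> = 2 * (\<integral>x. ?d x \<partial>cauchy)"
    using d integrable_cauchy_inverse[OF d] integral_cauchy_inverse[OF d]
    by (subst Bochner_Integration.integral_add) simp_all
  also have "(\<integral>x. ?d x \<partial>cauchy) = mu b - mu a"
    unfolding mu_def using assms by (intro Bochner_Integration.integral_diff integrable_xi) auto
  finally show ?thesis by simp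
qed

text \<open>The majorant affords exp (\<bar>ln x\<bar> / 2). One half of this exponent covers the
  exponential in the Taylor remainder, since \<bar>s\<bar> <= 1/4; the other half absorbs
  \<open>w\<^sup>2\<close>. The linear term stays exact so that its mean can be cancelled
  later.\<close>

lemma exp_scaled_le:
  fixes x s w :: real
  assumes "x > 0" "\<bar>s\<bar> \<le> 1 / 4" "\<bar>w\<bar> \<le> \<bar>ln x\<bar>"
  shows "exp (s * w) \<le> 1 + s * w + s\<^sup>2 * (32 / (exp 1)\<^sup>2) * (sqrt x + 1 / sqrt x)"
proof -
  let ?L = "\<bar>ln x\<bar>"
  have sw: "\<bar>s * w\<bar> \<le> ?L / 4"
    using mult_mono[OF assms(2,3)] by (simp add: abs_mult)
  have "w\<^sup>2 \<le> ?L\<^sup>2"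
    using assms(3) by (simp add: abs_le_square_iff)
  also have "\<dots> \<le> 64 / (exp 1)\<^sup>2 * exp (?L / 4)"
    using square_le_exp[of "?L / 4"] by (simp add: power_divide)
  finally have "w\<^sup>2 * exp \<bar>s * w\<bar> \<le> 64 / (exp 1)\<^sup>2 * exp (?L / 4) * exp (?L / 4)"
    using sw by (intro mult_mono) auto
  also have "\<dots> = 64 / (exp 1)\<^sup>2 * exp (?L / 2)"
    by (simp add: exp_add[symmetric])
  also have "\<dots> \<le> 64 / (exp 1)\<^sup>2 * (sqrt x + 1 / sqrt x)"
    using exp_half_abs_ln_le[OF assms(1)] by (intro mult_left_mono) auto
  finally have "s\<^sup>2 / 2 * (w\<^sup>2 * exp \<bar>s * w\<bar>) \<le> s\<^sup>2 / 2 * (64 / (exp 1)\<^sup>2 * (sqrt x + 1 / sqrt x))"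
    by (intro mult_left_mono) auto
  moreover have eq: "s\<^sup>2 / 2 * (64 / (exp 1)\<^sup>2 * h) = s\<^sup>2 * (32 / (exp 1)\<^sup>2) * h" for h :: real
    by simp
  ultimately have "1 + s * w + s\<^sup>2 / 2 * (w\<^sup>2 * exp \<bar>s * w\<bar>) \<le>
      1 + s * w + s\<^sup>2 * (32 / (exp 1)\<^sup>2) * (sqrt x + 1 / sqrt x)"
    unfolding eq by (intro add_left_mono)
  moreover have "exp (s * w) \<le> 1 + s * w + s\<^sup>2 / 2 * (w\<^sup>2 * exp \<bar>s * w\<bar>)"
    using exp_le_quadratic_exp_abs[of "s * w"] by (simp add: power_mult_distrib)
  ultimately show ?thesis by (rule order_trans[rotated])
qed

text \<open>Comparing with \<open>xi l\<close>, which lies within \<open>\<bar>ln \<bar>x\<bar>\<bar>\<close> of \<open>xi (l * \<bar>x\<bar>)\<close>, rather than with the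
  mean makes the bound uniform in \<open>l\<close>.\<close>

lemma xi_moment_generating_bound:
  assumes l: "l \<ge> 0" and s: "\<bar>s\<bar> \<le> 1 / 4"
  shows "(\<integral>\<^sup>+x. ennreal (exp (s * (xi (l * \<bar>x\<bar>) - mu l))) \<partial>cauchy) \<le> ennreal (exp (25 / 2 * s\<^sup>2))"
proof -
  let ?W = "\<lambda>x. xi (l * \<bar>x\<bar>) - xi l" and ?h = "\<lambda>x :: real. sqrt \<bar>x\<bar> + 1 / sqrt \<bar>x\<bar>"
  define B where "B = s\<^sup>2 * (32 / (exp 1)\<^sup>2)"
  define m where "m = (\<integral>x. ?W x \<partial>cauchy)"
  have m: "m = mu l - xi l"
    unfolding m_def mu_def using integrable_xi[OF l] cauchy.prob_space by simp
  have ae: "AE x in cauchy. exp (s * ?W x) \<le> 1 + s * ?W x + B * ?h x"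
    using AE_cauchy_nonzero
    by eventually_elim (use exp_scaled_le[OF _ s abs_xi_diff_le[OF l]] in \<open>simp add: B_def\<close>)
  have h: "integrable cauchy ?h" "(\<integral>x. ?h x \<partial>cauchy) = 2 * sqrt 2"
    using cauchy_sqrt_moment by (simp_all add: has_bochner_integral_iff)
  note W = integrable_xi_diff[OF l]
  have int: "integrable cauchy (\<lambda>x. 1 + s * ?W x + B * ?h x)"
    by (intro Bochner_Integration.integrable_add integrable_mult_right h W) simp
  have "(\<integral>\<^sup>+x. ennreal (exp (s * ?W x)) \<partial>cauchy) \<le> (\<integral>\<^sup>+x. ennreal (1 + s * ?W x + B * ?h x) \<partial>cauchy)"
    using ae by (intro nn_integral_mono_AE) (auto elim!: eventually_mono intro: ennreal_leI)
  also have "\<dots> = ennreal (\<integral>x. 1 + s * ?W x + B * ?h x \<partial>cauchy)"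
  proof (rule nn_integral_eq_integral[OF int])
    show "AE x in cauchy. 0 \<le> 1 + s * ?W x + B * ?h x"
      using ae by eventually_elim (rule order_trans[OF exp_ge_zero])
  qed
  also have "(\<integral>x. 1 + s * ?W x + B * ?h x \<partial>cauchy) = 1 + s * m + B * (2 * sqrt 2)"
    using h W cauchy.prob_space unfolding m_def
    by (subst Bochner_Integration.integral_add, simp_all)+
  \<comment> \<open>The coefficient of \<open>s\<^sup>2\<close> is 64 sqrt 2 / e^2; the estimates e
    >= 2.7 and sqrt 2 <= 1.42 just suffice to bound it by 25/2.\<close>
  also have "1 + s * m + B * (2 * sqrt 2) \<le> 1 + (s * m + 25 / 2 * s\<^sup>2)"
  proof -
    have "(27 / 10 :: real) \<le> exp 1" using e_approx_32 by (simp add: abs_if split: if_splits)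
    then have "(27 / 10 :: real)\<^sup>2 \<le> (exp 1)\<^sup>2" by (intro power_mono) auto
    then have e: "(729 / 100 :: real) \<le> (exp 1)\<^sup>2" by (simp add: power_divide)
    have "sqrt 2 \<le> (71 / 50 :: real)" by (rule real_le_lsqrt) (auto simp: power_divide)
    then have "64 * sqrt 2 \<le> 25 / 2 * (exp 1)\<^sup>2" using e by linarith
    then have "32 / (exp 1)\<^sup>2 * (2 * sqrt 2) \<le> 25 / 2" by (simp add: divide_le_eq)
    from mult_left_mono[OF this zero_le_power2[of s]] show ?thesis by (simp add: B_def mult_ac)
  qed
  also have "\<dots> \<le> exp (s * m + 25 / 2 * s\<^sup>2)" by (rule exp_ge_add_one_self)
  finally have bound: "(\<integral>\<^sup>+x. ennreal (exp (s * ?W x)) \<partial>cauchy) \<le> ennreal (exp (s * m + 25 / 2 * s\<^sup>2))"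
    by (simp add: ennreal_leI)
  \<comment> \<open>Recentring from \<open>xi l\<close> to \<open>mu l\<close> multiplies by
    \<open>exp (- (s * m))\<close>, which cancels the linear term exactly.\<close>
  have "exp (s * (xi (l * \<bar>x\<bar>) - mu l)) = exp (- (s * m)) * exp (s * ?W x)" for x
    unfolding m by (simp add: exp_add[symmetric] algebra_simps)
  then have "(\<integral>\<^sup>+x. ennreal (exp (s * (xi (l * \<bar>x\<bar>) - mu l))) \<partial>cauchy) =
      ennreal (exp (- (s * m))) * (\<integral>\<^sup>+x. ennreal (exp (s * ?W x)) \<partial>cauchy)"
    by (subst nn_integral_cmult[symmetric]) (auto simp: ennreal_mult')
  also have "\<dots> \<le> ennreal (exp (- (s * m))) * ennreal (exp (s * m + 25 / 2 * s\<^sup>2))"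
    by (intro mult_left_mono bound) simp
  also have "\<dots> = ennreal (exp (25 / 2 * s\<^sup>2))"
    by (simp add: ennreal_mult'[symmetric] exp_add[symmetric])
  finally show ?thesis .
qed

section \<open>Concentration and the union bound\<close>

text \<open>Chernoff's method: independence factors the exponential moment. The sign \<sigma> treats
  both tails at once.\<close>

lemma (in prob_space) xi_sum_tail:
  fixes Y :: "'i :: finite \<Rightarrow> 'a \<Rightarrow> real"
  assumes indep: "indep_vars (\<lambda>_. borel) Y UNIV" and Y: "\<And>i. distr M borel (Y i) = cauchy"
    and l: "l \<ge> 0" and \<sigma>: "\<bar>\<sigma>\<bar> = 1" and \<delta>: "0 < \<delta>" "\<delta> \<le> 1"
  shows "prob {\<omega> \<in> space M. real CARD('i) * \<delta> \<le> (\<Sum>i\<in>UNIV. \<sigma> * (xi (l * \<bar>Y i \<omega>\<bar>) - mu l))}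
    \<le> exp (- (real CARD('i) * \<delta>\<^sup>2 / 50))"
proof -
  let ?n = "real CARD('i)"
  let ?Z = "\<lambda>i \<omega>. \<sigma> * (xi (l * \<bar>Y i \<omega>\<bar>) - mu l)"
  \<comment> \<open>This minimizes \<open>- s * \<delta> + 25 / 2 * s\<^sup>2\<close>, with value
    \<open>- \<delta>\<^sup>2 / 50\<close>. Since \<delta> <= 1, it stays in the range \<bar>s\<bar>
    <= 1/4 of the moment bound.\<close>
  define s where "s = \<delta> / 25"
  have s: "0 < s" "\<bar>s * \<sigma>\<bar> \<le> 1 / 4" "(s * \<sigma>)\<^sup>2 = s\<^sup>2"
    using \<delta> \<sigma> power2_abs[of \<sigma>] by (simp_all add: s_def abs_mult power_mult_distrib power_divide)
  have [measurable]: "Y i \<in> borel_measurable M" for i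
    using indep by (auto simp: indep_vars_def)
  have factor: "(\<integral>\<^sup>+\<omega>. ennreal (exp (s * ?Z i \<omega>)) \<partial>M) \<le> ennreal (exp (25 / 2 * s\<^sup>2))" for i
  proof -
    have "(\<integral>\<^sup>+\<omega>. ennreal (exp (s * ?Z i \<omega>)) \<partial>M) =
        (\<integral>\<^sup>+x. ennreal (exp (s * \<sigma> * (xi (l * \<bar>x\<bar>) - mu l))) \<partial>distr M borel (Y i))"
      by (subst nn_integral_distr) (simp_all add: mult.assoc)
    then show ?thesis
      using xi_moment_generating_bound[OF l s(2)] unfolding Y s(3) by simp
  qed
  have "(\<integral>\<^sup>+\<omega>. ennreal (exp (s * (\<Sum>i\<in>UNIV. ?Z i \<omega>))) \<partial>M) =
      (\<integral>\<^sup>+\<omega>. (\<Prod>i\<in>UNIV. ennreal (exp (s * ?Z i \<omega>))) \<partial>M)"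
    by (intro nn_integral_cong) (simp add: sum_distrib_left exp_sum prod_ennreal)
  also have "\<dots> = (\<Prod>i\<in>UNIV. \<integral>\<^sup>+\<omega>. ennreal (exp (s * ?Z i \<omega>)) \<partial>M)"
    by (intro indep_vars_nn_integral indep_vars_compose2[OF indep]) auto
  also have "\<dots> \<le> (\<Prod>i\<in>(UNIV :: 'i set). ennreal (exp (25 / 2 * s\<^sup>2)))"
    by (intro prod_mono_ennreal factor)
  also have "\<dots> = ennreal (exp (?n * (25 / 2 * s\<^sup>2)))"
    by (simp add: ennreal_power flip: exp_of_nat_mult)
  finally have mgf: "(\<integral>\<^sup>+\<omega>. ennreal (exp (s * (\<Sum>i\<in>UNIV. ?Z i \<omega>))) \<partial>M) \<le> ennreal (exp (?n * (25 / 2 * s\<^sup>2)))" .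
  have "emeasure M {\<omega> \<in> space M. ?n * \<delta> \<le> (\<Sum>i\<in>UNIV. ?Z i \<omega>)} \<le>
      ennreal (exp (- s * (?n * \<delta>))) *
        (\<integral>\<^sup>+\<omega>. ennreal (exp (s * (\<Sum>i\<in>UNIV. ?Z i \<omega>))) * indicator (space M) \<omega> \<partial>M)"
    using s(1) by (intro Chernoff_ineq_nn_integral_ge) auto
  also have "(\<integral>\<^sup>+\<omega>. ennreal (exp (s * (\<Sum>i\<in>UNIV. ?Z i \<omega>))) * indicator (space M) \<omega> \<partial>M) =
      (\<integral>\<^sup>+\<omega>. ennreal (exp (s * (\<Sum>i\<in>UNIV. ?Z i \<omega>))) \<partial>M)"
    by (intro nn_integral_cong) simp
  also have "ennreal (exp (- s * (?n * \<delta>))) * \<dots> \<le>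
      ennreal (exp (- s * (?n * \<delta>))) * ennreal (exp (?n * (25 / 2 * s\<^sup>2)))"
    by (intro mult_left_mono mgf) simp
  also have "\<dots> = ennreal (exp (- s * (?n * \<delta>) + ?n * (25 / 2 * s\<^sup>2)))"
    by (simp add: ennreal_mult'[symmetric] exp_add[symmetric])
  also have "- s * (?n * \<delta>) + ?n * (25 / 2 * s\<^sup>2) = - (?n * \<delta>\<^sup>2 / 50)"
    by (simp add: s_def power2_eq_square field_simps)
  finally show ?thesis
    by (simp add: emeasure_eq_measure)
qed

text \<open>Different rows use disjoint blocks of an independent family, which gives independence;
  within a row 1-stability gives the law.\<close>

lemma (in prob_space)
  fixes Z :: "'i :: finite \<times> 'j :: finite \<Rightarrow> 'a \<Rightarrow> real" and w :: "'j \<Rightarrow> real"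
  assumes indep: "indep_vars (\<lambda>_. borel) Z UNIV"
    and Z: "\<And>p. distributed M lborel (Z p) cauchy_density"
    and w: "(\<Sum>j\<in>UNIV. \<bar>w j\<bar>) > 0"
  defines "Y \<equiv> \<lambda>i \<omega>. (\<Sum>j\<in>UNIV. w j * Z (i, j) \<omega>) / (\<Sum>j\<in>UNIV. \<bar>w j\<bar>)"
  shows indep_row_combinations: "indep_vars (\<lambda>_. borel) Y UNIV"
    and distr_row_combination: "distr M borel (Y i) = cauchy"
proof -
  let ?l = "\<Sum>j\<in>UNIV. \<bar>w j\<bar>" and ?R = "\<lambda>i. {i} \<times> (UNIV :: 'j set)"
  have "indep_vars (\<lambda>_. borel) (\<lambda>i \<omega>. (\<Sum>j\<in>UNIV. w j * (\<lambda>p\<in>?R i. Z p \<omega>) (i, j)) / ?l) UNIV"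
  proof (rule indep_vars_compose2[where Y = "\<lambda>i f. (\<Sum>j\<in>UNIV. w j * f (i, j)) / ?l"])
    show "indep_vars (\<lambda>i. PiM (?R i) (\<lambda>_. borel)) (\<lambda>i \<omega>. \<lambda>p\<in>?R i. Z p \<omega>) UNIV"
      by (rule indep_vars_restrict[OF indep]) (auto simp: disjoint_family_on_def)
  qed measurable
  then show "indep_vars (\<lambda>_. borel) Y UNIV" by (simp add: Y_def)
  have sum_row: "(\<Sum>p\<in>?R i. g p) = (\<Sum>j\<in>UNIV. g (i, j))" for g :: "'i \<times> 'j \<Rightarrow> real"
    using sum.cartesian_product[of "\<lambda>a b. g (a, b)" UNIV "{i}"] by simp
  have "distributed M lborel (\<lambda>\<omega>. (\<Sum>p\<in>?R i. w (snd p) * Z p \<omega>) / (\<Sum>p\<in>?R i. \<bar>w (snd p)\<bar>)) cauchy_density"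
    using indep_vars_subset[OF indep] Z w by (intro linear_combination_cauchy) (auto simp: sum_row)
  then have "distributed M lborel (Y i) cauchy_density"
    by (simp add: sum_row Y_def)
  then have "distr M lborel (Y i) = cauchy"
    unfolding cauchy_def by (rule distributed_distr_eq_density)
  then show "distr M borel (Y i) = cauchy"
    by (simp cong: distr_cong)
qed

text \<open>This is \<open>mu_increment\<close> at \<open>b = (1 + \<epsilon>) * a\<close>, combined
  with ln (1 + \<epsilon>) >= \<epsilon> - \<epsilon>^2. It serves both sides of the target
  interval, with \<open>a\<close> equal to the distance or to the distance divided by
  \<open>1 + \<epsilon>\<close>.\<close>

lemma mu_increment_one_plus:
  assumes "0 < \<epsilon>" "\<epsilon> < 1" and a: "0 < a" "1 \<le> a\<^sup>2 * (1 + \<epsilon>)"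
  shows "\<epsilon> * (1 - \<epsilon>) / 2 \<le> mu ((1 + \<epsilon>) * a) - mu a"
proof -
  have "\<epsilon> - \<epsilon>\<^sup>2 \<le> ln (1 + \<epsilon>)"
    using assms by (intro ln_one_plus_pos_lower_bound) auto
  moreover have "ln ((1 + \<epsilon>) * a / a) / 2 \<le> mu ((1 + \<epsilon>) * a) - mu a"
    using assms by (intro mu_increment) (auto simp: power2_eq_square algebra_simps)
  moreover have "ln ((1 + \<epsilon>) * a / a) = ln (1 + \<epsilon>)" "\<epsilon> * (1 - \<epsilon>) = \<epsilon> - \<epsilon>\<^sup>2"
    using a by (simp_all add: power2_eq_square right_diff_distrib)
  ultimately show ?thesis by simp
qed

text \<open>The exponent is n \<epsilon>^2 (1 - \<epsilon>)^2 / 200, while 32 pi^2 > 300. The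
  comparison 200 (c + 3) <= 300 (c + 2), an equality at c = 0, gains one power of N, which pays for
  the union bound.\<close>

lemma tail_bound_le:
  fixes n N c \<epsilon> C :: real
  assumes "N \<ge> 2" "0 < \<epsilon>" "\<epsilon> < 1" "c > 0"
    and C: "C \<ge> 32 * pi\<^sup>2" and n: "n \<ge> C / (\<epsilon>\<^sup>2 * (1 - \<epsilon>)\<^sup>2) * ln (N powr (c + 2))"
  shows "exp (- (n * (\<epsilon> * (1 - \<epsilon>) / 2)\<^sup>2 / 50)) \<le> N powr - (c + 3)"
proof -
  have "(3.1 :: real)\<^sup>2 \<le> pi\<^sup>2"
    using pi_approx by (intro power_mono) auto
  then have C300: "C \<ge> 300" using C by (simp add: power2_eq_square)
  have lnN: "ln N > 0" using assms by simp
  have e: "\<epsilon>\<^sup>2 * (1 - \<epsilon>)\<^sup>2 > 0" using assms by simp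
  have "C * ((c + 2) * ln N) \<le> n * (\<epsilon>\<^sup>2 * (1 - \<epsilon>)\<^sup>2)"
    using n assms e by (simp add: ln_powr pos_divide_le_eq)
  moreover have "300 * ((c + 2) * ln N) \<le> C * ((c + 2) * ln N)"
    using C300 assms lnN by (intro mult_right_mono) auto
  moreover have "200 * ((c + 3) * ln N) \<le> 300 * ((c + 2) * ln N)"
  proof -
    have "200 * (c + 3) * ln N \<le> 300 * (c + 2) * ln N"
      using assms lnN by (intro mult_right_mono) auto
    then show ?thesis by (simp only: mult.assoc)
  qed
  ultimately have "200 * ((c + 3) * ln N) \<le> n * (\<epsilon>\<^sup>2 * (1 - \<epsilon>)\<^sup>2)" by linarith
  then have "(c + 3) * ln N \<le> n * (\<epsilon> * (1 - \<epsilon>) / 2)\<^sup>2 / 50"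
    by (simp add: power_mult_distrib power_divide)
  then show ?thesis using assms by (simp add: powr_def algebra_simps)
qed

theorem theorem1p0p1:
  fixes P :: "(real ^ 'd) set"
    and N :: nat
    and \<epsilon> c C :: real
    and M :: "'w measure"
    and F :: "'w \<Rightarrow> real ^ 'd \<Rightarrow> real ^ 'k"
  assumes "card P = N" and "N \<ge> 2"
    and "0 < \<epsilon>" and "\<epsilon> < 1" and "c > 0"
    and "C = 64 * (pi\<^sup>2 / 2 + 16 * sqrt 2 / (exp 1 * pi) * exp (artanh (1 / sqrt 2)))"
    and "real CARD('k) \<ge> C / (\<epsilon>\<^sup>2 * (1 - \<epsilon>)\<^sup>2) * ln (real N powr (c + 2))"
    and "prob_space M"
    and "\<And>\<omega>. \<omega> \<in> space M \<Longrightarrow> linear (F \<omega>)"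
    and "prob_space.indep_vars M (\<lambda>_. borel) (\<lambda>(i, j) \<omega>. matrix (F \<omega>) $ i $ j) UNIV"
    and "\<And>i j. distributed M lborel (\<lambda>\<omega>. matrix (F \<omega>) $ i $ j) cauchy_density"
  shows "measure M {\<omega> \<in> space M. \<forall>x\<in>P. \<forall>y\<in>P. norm_1 (x - y) \<ge> sqrt (1 + \<epsilon>) \<longrightarrow>
           mu (norm_1 (x - y) / (1 + \<epsilon>)) \<le> rho (F \<omega> x) (F \<omega> y) \<and>
           rho (F \<omega> x) (F \<omega> y) \<le> mu ((1 + \<epsilon>) * norm_1 (x - y))}
         \<ge> 1 - real N powr (- c)"
proof -
  interpret prob_space M by fact
  define n where "n = real CARD('k)"
  define \<delta> where "\<delta> = \<epsilon> * (1 - \<epsilon>) / 2"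
  define Z :: "'k \<times> 'd \<Rightarrow> 'w \<Rightarrow> real" where "Z = (\<lambda>(i, j) \<omega>. matrix (F \<omega>) $ i $ j)"
  \<comment> \<open>On \<open>space M\<close>, \<open>S d i \<omega>\<close> is coordinate
    \<open>i\<close> of \<open>F \<omega> d\<close>. Working with entries makes measurability of
    \<open>R\<close>, \<open>bad\<close> and \<open>G\<close> immediate; \<open>rho_R\<close>
    translates back.\<close>
  define S where "S d i \<omega> = (\<Sum>j\<in>UNIV. d $ j * Z (i, j) \<omega>)" for d i \<omega>
  define R where "R d \<omega> = 1 / n * (\<Sum>i\<in>UNIV. xi \<bar>S d i \<omega>\<bar>)" for d \<omega>
  define bad where "bad \<sigma> d = {\<omega> \<in> space M. n * \<delta> \<le> (\<Sum>i\<in>UNIV. \<sigma> * (xi \<bar>S d i \<omega>\<bar> - mu (norm_1 d)))}"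
    for \<sigma> :: real and d
  define Q where "Q = {q \<in> P \<times> P. sqrt (1 + \<epsilon>) \<le> norm_1 (fst q - snd q)}"
  define B where "B = (\<Union>(q, \<sigma>)\<in>Q \<times> {1, -1}. bad \<sigma> (fst q - snd q))"
  define G where "G = {\<omega> \<in> space M. \<forall>x\<in>P. \<forall>y\<in>P. norm_1 (x - y) \<ge> sqrt (1 + \<epsilon>) \<longrightarrow>
    mu (norm_1 (x - y) / (1 + \<epsilon>)) \<le> R (x - y) \<omega> \<and> R (x - y) \<omega> \<le> mu ((1 + \<epsilon>) * norm_1 (x - y))}"
  have finP [measurable]: "finite P" using assms(1,2) by (metis card.infinite not_numeral_le_zero)
  have n: "n > 0" by (simp add: n_def)
  have "\<epsilon> * (1 - \<epsilon>) \<le> 1 * 1" using assms(3,4) by (intro mult_mono) auto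
  then have \<delta>: "0 < \<delta>" "\<delta> \<le> 1" using assms(3,4) by (simp_all add: \<delta>_def)
  have Z: "distributed M lborel (Z p) cauchy_density" for p
    using assms(11) by (cases p) (simp add: Z_def)
  have indep: "indep_vars (\<lambda>_. borel) Z UNIV" using assms(10) by (simp add: Z_def)
  have [measurable]: "Z p \<in> borel_measurable M" for p
    using distributed_measurable[OF Z[of p]] by simp
  have [measurable]: "S d i \<in> borel_measurable M" for d i unfolding S_def by measurable
  have [measurable]: "R d \<in> borel_measurable M" for d unfolding R_def by measurable
  have [measurable]: "bad \<sigma> d \<in> sets M" for \<sigma> d unfolding bad_def by measurable
  have [measurable]: "G \<in> sets M" unfolding G_def by measurable

  have rho_R: "rho (F \<omega> x) (F \<omega> y) = R (x - y) \<omega>" if "\<omega> \<in> space M" for \<omega> x y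
  proof -
    have lin: "linear (F \<omega>)" using assms(9) that .
    have "F \<omega> x $ i - F \<omega> y $ i = S (x - y) i \<omega>" for i
    proof -
      have "F \<omega> x $ i - F \<omega> y $ i = F \<omega> (x - y) $ i"
        using linear_diff[OF lin] by simp
      also have "F \<omega> (x - y) = matrix (F \<omega>) *v (x - y)"
        using matrix_vector_mul(2)[OF lin] by metis
      finally show ?thesis by (simp add: matrix_vector_mult_def S_def Z_def mult.commute)
    qed
    then show ?thesis by (simp add: rho_def R_def n_def)
  qed

  have prob_bad: "prob (bad \<sigma> d) \<le> real N powr - (c + 3)" if d: "norm_1 d > 0" and \<sigma>: "\<bar>\<sigma>\<bar> = 1" for \<sigma> d
  proof -
    let ?Y = "\<lambda>i \<omega>. (\<Sum>j\<in>UNIV. d $ j * Z (i, j) \<omega>) / (\<Sum>j\<in>UNIV. \<bar>d $ j\<bar>)"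
    have w: "(\<Sum>j\<in>UNIV. \<bar>d $ j\<bar>) > 0" using d by (simp add: norm_1_def)
    \<comment> \<open>The normalized row combination \<open>?Y\<close> is standard Cauchy, so
      \<open>norm_1 d\<close> takes the role of \<open>l\<close> in the tail bound.\<close>
    have scale: "norm_1 d * \<bar>?Y i \<omega>\<bar> = \<bar>S d i \<omega>\<bar>" for i \<omega>
      using w by (simp add: norm_1_def S_def abs_divide)
    have "prob (bad \<sigma> d) \<le> exp (- (n * \<delta>\<^sup>2 / 50))"
      using xi_sum_tail[OF indep_row_combinations[OF indep Z w] distr_row_combination[OF indep Z w]
          less_imp_le[OF d] \<sigma> \<delta>]
      unfolding scale bad_def n_def .
    also have "\<dots> \<le> real N powr - (c + 3)"
      unfolding \<delta>_def using assms(2-5,7) unfolding n_def[symmetric]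
      by (intro tail_bound_le[where C = C]) (auto simp: assms(6))
    finally show ?thesis .
  qed

  have "space M - B \<subseteq> G"
  proof
    fix \<omega> assume \<omega>: "\<omega> \<in> space M - B"
    have "mu (norm_1 (x - y) / (1 + \<epsilon>)) \<le> R (x - y) \<omega> \<and> R (x - y) \<omega> \<le> mu ((1 + \<epsilon>) * norm_1 (x - y))"
      if xy: "x \<in> P" "y \<in> P" "norm_1 (x - y) \<ge> sqrt (1 + \<epsilon>)" for x y
    proof -
      let ?l = "norm_1 (x - y)"
      have l1: "1 \<le> ?l" using xy(3) assms(3) real_sqrt_ge_1_iff[of "1 + \<epsilon>"] by linarith
      have l2: "1 + \<epsilon> \<le> ?l\<^sup>2"
        using power_mono[OF xy(3), of 2] assms(3) by simp
      have upper: "\<delta> \<le> mu ((1 + \<epsilon>) * ?l) - mu ?l"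
        unfolding \<delta>_def using l1 l2 assms(3,4) mult_mono[of 1 "?l\<^sup>2" 1 "1 + \<epsilon>"]
        by (intro mu_increment_one_plus) auto
      \<comment> \<open>For the lower side, the condition on
        \<open>a = ?l / (1 + \<epsilon>)\<close> reads \<open>1 + \<epsilon> <= ?l\<^sup>2\<close>;
        this is the source of the threshold \<open>sqrt (1 + \<epsilon>)\<close>.\<close>
      have "(?l / (1 + \<epsilon>))\<^sup>2 * (1 + \<epsilon>) = ?l\<^sup>2 / (1 + \<epsilon>)"
        using assms(3) by (simp add: power2_eq_square)
      then have "\<delta> \<le> mu ((1 + \<epsilon>) * (?l / (1 + \<epsilon>))) - mu (?l / (1 + \<epsilon>))"
        unfolding \<delta>_def using l1 l2 assms(3,4) by (intro mu_increment_one_plus) simp_all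
      then have lower: "\<delta> \<le> mu ?l - mu (?l / (1 + \<epsilon>))" using assms(3) by simp
      have "(x, y) \<in> Q" using xy by (simp add: Q_def)
      then have "\<omega> \<notin> bad 1 (x - y)" "\<omega> \<notin> bad (-1) (x - y)"
        using \<omega> by (force simp: B_def)+
      then have "(\<Sum>i\<in>UNIV. 1 * (xi \<bar>S (x - y) i \<omega>\<bar> - mu ?l)) < n * \<delta>"
        "(\<Sum>i\<in>UNIV. -1 * (xi \<bar>S (x - y) i \<omega>\<bar> - mu ?l)) < n * \<delta>"
        using \<omega> by (auto simp: bad_def not_le)
      moreover have sum_eq: "(\<Sum>i\<in>UNIV. \<sigma> * (xi \<bar>S (x - y) i \<omega>\<bar> - mu ?l)) = n * (\<sigma> * (R (x - y) \<omega> - mu ?l))" for \<sigma>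
        using n by (simp add: R_def n_def sum_distrib_left[symmetric] sum_subtractf right_diff_distrib)
      ultimately have "R (x - y) \<omega> - mu ?l < \<delta>" "- (R (x - y) \<omega> - mu ?l) < \<delta>"
        unfolding sum_eq using n by simp_all
      then show ?thesis using upper lower by linarith
    qed
    then show "\<omega> \<in> G" using \<omega> by (auto simp: G_def)
  qed
  moreover have finQ: "finite Q" using finP by (simp add: Q_def)
  then have B_sets [measurable]: "B \<in> sets M"
    unfolding B_def by (intro sets.finite_UN) auto
  ultimately have "1 - prob B \<le> prob G"
    using finite_measure_mono[of "space M - B" G] by (simp add: prob_compl)
  moreover have "prob B \<le> real N powr - c"
  proof -
    have "prob B \<le> (\<Sum>(q, \<sigma>)\<in>Q \<times> {1, -1}. prob (bad \<sigma> (fst q - snd q)))"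
      using measure_UNION_le[of "Q \<times> {1, -1}" "\<lambda>(q, \<sigma>). bad \<sigma> (fst q - snd q)" M] finQ
      by (auto simp: B_def case_prod_unfold)
    also have "\<dots> \<le> (\<Sum>(q, \<sigma>)\<in>Q \<times> {1, -1 :: real}. real N powr - (c + 3))"
    proof (intro sum_mono, clarify)
      fix x y and \<sigma> :: real assume xy: "(x, y) \<in> Q" "\<sigma> \<in> {1, -1}"
      have "0 < sqrt (1 + \<epsilon>)" using assms(3) by simp
      also have "\<dots> \<le> norm_1 (x - y)" using xy by (simp add: Q_def)
      finally show "prob (bad \<sigma> (fst (x, y) - snd (x, y))) \<le> real N powr - (c + 3)"
        using xy by (intro prob_bad) auto
    qed
    also have "\<dots> = real (card Q) * 2 * real N powr - (c + 3)"
      by (simp add: card_cartesian_product case_prod_unfold)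
    \<comment> \<open>There are at most N^2 ordered pairs with two signs each, and 2 <= N absorbs
      the factor 2 into a third power of N.\<close>
    also have "\<dots> \<le> real N * real N * real N * real N powr - (c + 3)"
    proof (intro mult_right_mono mult_mono)
      have "card Q \<le> card (P \<times> P)" using finP by (intro card_mono) (auto simp: Q_def)
      then show "real (card Q) \<le> real N * real N"
        using assms(1) by (simp add: card_cartesian_product flip: of_nat_mult)
    qed (use assms(2) in auto)
    also have "\<dots> = real N powr 3 * real N powr - (c + 3)"
      using assms(2) by (simp add: powr_numeral power3_eq_cube)
    also have "\<dots> = real N powr - c"
      unfolding powr_add[symmetric] by simp
    finally show ?thesis .
  qed
  moreover have "{\<omega> \<in> space M. \<forall>x\<in>P. \<forall>y\<in>P. norm_1 (x - y) \<ge> sqrt (1 + \<epsilon>) \<longrightarrow>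
      mu (norm_1 (x - y) / (1 + \<epsilon>)) \<le> rho (F \<omega> x) (F \<omega> y) \<and>
      rho (F \<omega> x) (F \<omega> y) \<le> mu ((1 + \<epsilon>) * norm_1 (x - y))} = G"
    unfolding G_def by (intro Collect_cong conj_cong refl) (simp add: rho_R)
  ultimately show ?thesis by simp
qed

end
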